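(* Let $m,n$ be positive integers and let $F_{m,n}=E_m+P_n$ be the generalized fan graph. The double vertex graph $F_{m,n}^{\{2\}}$ is Hamiltonian if and only if either $n\geq 2$ and $1\leq m\leq 2n$, or $n=1$ and $m=3$.
   Context: All graphs are simple. For a graph $G$ of order $n$ and an integer $1\leq k\leq n-1$, the $k$-token graph $G^{\{k\}}$ is the graph whose vertices are the $k$-element subsets of $V(G)$, two such subsets being adjacent whenever their symmetric difference is a pair $\{u,v\}$ with $uv\in E(G)$. The $2$-token graph is called the double vertex graph. For disjoint graphs $G,H$, the join $G+H$ has vertex set $V(G)\cup V(H)$ and edge set $E(G)\cup E(H)\cup\{xy: x\in V(G), y\in V(H)\}$. $E_m$ denotes the edgeless graph on $m$ vertices and $P_n$ the path on $n$ vertices; $F_{m,n}=E_m+P_n$. A graph is Hamiltonian if it has a cycle through every vertex exactly once. *)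

theory Defs
  imports "Graph_Theory.Pair_Digraph"
begin

text \<open>
  A finite simple graph is a \<^locale>\<open>pair_graph\<close>: a finite, loopfree, symmetric digraph without
  parallel arcs, an edge \<open>uv\<close> being represented by the two arcs \<open>(u, v)\<close> and \<open>(v, u)\<close>.
\<close>

definition edgeless_graph :: "nat \<Rightarrow> nat pair_pre_digraph" where
  "edgeless_graph m = \<lparr> pverts = {..<m}, parcs = {} \<rparr>"

definition path_graph :: "nat \<Rightarrow> nat pair_pre_digraph" where
  "path_graph n = \<lparr> pverts = {..<n}, parcs = {(i, j). i < n \<and> j < n \<and> (j = Suc i \<or> i = Suc j)} \<rparr>"

text \<open>The sum type makes the vertex sets of the two arguments of the join disjoint.\<close>

definition graph_join ::
  "'a pair_pre_digraph \<Rightarrow> 'b pair_pre_digraph \<Rightarrow> ('a + 'b) pair_pre_digraph" where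
  "graph_join G H =
    \<lparr> pverts = pverts G <+> pverts H,
      parcs = {(Inl x, Inl y) | x y. (x, y) \<in> parcs G}
        \<union> {(Inr x, Inr y) | x y. (x, y) \<in> parcs H}
        \<union> {(Inl x, Inr y) | x y. x \<in> pverts G \<and> y \<in> pverts H}
        \<union> {(Inr y, Inl x) | x y. x \<in> pverts G \<and> y \<in> pverts H} \<rparr>"

definition fan_graph :: "nat \<Rightarrow> nat \<Rightarrow> (nat + nat) pair_pre_digraph" where
  "fan_graph m n = graph_join (edgeless_graph m) (path_graph n)"

definition token_graph :: "nat \<Rightarrow> 'a pair_pre_digraph \<Rightarrow> 'a set pair_pre_digraph" where
  "token_graph k G =
    (let V = {A. A \<subseteq> pverts G \<and> finite A \<and> card A = k}
     in \<lparr> pverts = V,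
          parcs = {(A, B). A \<in> V \<and> B \<in> V \<and> (\<exists>u v. (u, v) \<in> parcs G \<and> (A - B) \<union> (B - A) = {u, v})} \<rparr>)"

abbreviation double_vertex_graph :: "'a pair_pre_digraph \<Rightarrow> 'a set pair_pre_digraph" where
  "double_vertex_graph G \<equiv> token_graph 2 G"

text \<open>
  The cycles of the digraph library are closed walks, given as lists of arcs, that repeat no vertex
  except that the last one is the first one. They include \<open>[(u, v), (v, u)]\<close>, which is not a
  cycle of an undirected graph; hence the bound on the length.
\<close>

definition hamiltonian :: "'a pair_pre_digraph \<Rightarrow> bool" where
  "hamiltonian G \<longleftrightarrow>
    (\<exists>p. pre_digraph.cycle (with_proj G) p \<and> 3 \<le> length p \<and> fst ` set p = pverts G)"

lemma pair_graphI:
  assumes "finite (pverts G)" and "parcs G \<subseteq> pverts G \<times> pverts G"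
    and "sym (parcs G)" and "irrefl (parcs G)"
  shows "pair_graph G"
proof -
  have "finite (parcs G)"
    using assms(1,2) by (meson finite_SigmaI finite_subset)
  with assms show ?thesis
    by unfold_locales (auto simp: symmetric_def irrefl_def)
qed

lemma pair_graphD:
  assumes "pair_graph G"
  shows "finite (pverts G)" and "parcs G \<subseteq> pverts G \<times> pverts G"
    and "sym (parcs G)" and "irrefl (parcs G)"
proof -
  interpret pair_graph G by fact
  show "finite (pverts G)" by (rule pair_finite_verts)
  show "parcs G \<subseteq> pverts G \<times> pverts G" by (auto dest: in_arcsD1 in_arcsD2)
  show "sym (parcs G)" using pair_sym_arcs by (simp add: symmetric_def)
  show "irrefl (parcs G)" using pair_no_loops by (force simp: irrefl_def)
qed

lemma pair_graph_edgeless_graph: "pair_graph (edgeless_graph m)"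
  by (rule pair_graphI) (auto simp: edgeless_graph_def sym_def irrefl_def)

lemma pair_graph_path_graph: "pair_graph (path_graph n)"
  by (rule pair_graphI) (auto simp: path_graph_def sym_def irrefl_def)

lemma pair_graph_graph_join:
  assumes "pair_graph G" and "pair_graph H"
  shows "pair_graph (graph_join G H)"
  using pair_graphD[OF assms(1)] pair_graphD[OF assms(2)]
  by (intro pair_graphI) (auto simp: graph_join_def sym_def irrefl_def)

lemma pair_graph_fan_graph: "pair_graph (fan_graph m n)"
  unfolding fan_graph_def
  by (intro pair_graph_graph_join pair_graph_edgeless_graph pair_graph_path_graph)

lemma pair_graph_token_graph:
  assumes "pair_graph G"
  shows "pair_graph (token_graph k G)"
  using pair_graphD[OF assms]
  by (intro pair_graphI) (auto simp: token_graph_def Let_def sym_def irrefl_def Un_commute)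

end

theory Submission
  imports Defs
begin

text \<open>
  Call a pair of tokens of type A, B, C if none, one, both of the tokens lie on the path. Pairs of
  type A are adjacent only to pairs of type B, pairs of type C only to pairs of type B or C. If
  \<open>n = 1\<close> then type C is empty and the graph is bipartite with parts A and B, so a Hamiltonian cycle
  forces \<open>m (m - 1) / 2 = m\<close>. If \<open>n \<ge> 2\<close> then type C is not empty, and deleting the \<open>m n\<close> pairs of
  type B leaves more than \<open>m (m - 1) / 2\<close> components, so \<open>m (m - 1) / 2 < m n\<close>.

  Conversely, let \<open>n \<ge> 2\<close> and \<open>m \<le> 2 n\<close>. The pairs of type B form \<open>m\<close> rows of length \<open>n\<close>, each of
  them a path, which are traversed one after the other. The pair \<open>{r, r + 1}\<close> of type A leads from
  row \<open>r\<close> to the next one, and the pair of the two ends of the path leads from the last row back to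
  row \<open>0\<close>. The other pairs of type C are inserted into row \<open>0\<close>. The remaining pairs \<open>{r, p}\<close> of
  type A are inserted into row \<open>r\<close> or row \<open>p\<close>, between any two consecutive entries at most one. To
  this end, the pairs in the rows \<open>1, \<dots>, 2 n - 1\<close> are distributed by the rotational tournament on
  \<open>2 n - 1\<close> points, each row receiving \<open>n - 1\<close> of them; the pair \<open>{r - 1, r}\<close>, already used, leaves
  its place in row \<open>r\<close> to \<open>{0, r}\<close>.
\<close>

section \<open>Hamiltonian cycles\<close>

text \<open>The arcs of the cycle arise by zipping the vertex list with its rotation by one
  place.\<close>

lemma hamiltonianI:
  assumes distinct: "distinct vs" and length: "3 \<le> length vs" and set: "set vs = pverts G"
    and succ: "successively (\<lambda>u v. (u, v) \<in> parcs G) vs" and close: "(last vs, hd vs) \<in> parcs G"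
  shows "hamiltonian G"
proof -
  obtain u ws where vs: "vs = u # ws"
    using length by (cases vs) simp_all
  have fst_zip: "map fst (zip vs (ws @ [u])) = vs" and snd_zip: "map snd (zip vs (ws @ [u])) = ws @ [u]"
    by (simp_all add: vs)
  have arcs: "set (zip (x # xs) (xs @ [y])) \<subseteq> parcs G"
    if "successively (\<lambda>u v. (u, v) \<in> parcs G) (x # xs)" "(last (x # xs), y) \<in> parcs G" for x xs y
    using that by (induction xs arbitrary: x) auto
  have cas: "pcas x (zip (x # xs) (xs @ [y])) y" for x y :: 'a and xs
    by (induction xs arbitrary: x) auto
  have verts: "pawalk_verts x p = x # map snd p" if "pcas x p y" for x y :: 'a and p
    using that by (induction p arbitrary: x) auto
  have "pre_digraph.cycle (with_proj G) (zip vs (ws @ [u]))"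
    unfolding pre_digraph.cycle_def pre_digraph.awalk_def
  proof (intro exI conjI)
    show "u \<in> verts (with_proj G)"
      using set by (auto simp: vs)
    show "set (zip vs (ws @ [u])) \<subseteq> arcs (with_proj G)"
      using arcs[of u ws u] succ close by (simp add: vs)
    show "pre_digraph.cas (with_proj G) u (zip vs (ws @ [u])) u"
      using cas[of u ws u] by (simp add: vs cas_with_proj_eq)
    show "distinct (tl (pre_digraph.awalk_verts (with_proj G) u (zip vs (ws @ [u]))))"
      using verts[OF cas[of u ws u]] distinct snd_zip by (simp add: vs awalk_verts_with_proj_eq)
    show "zip vs (ws @ [u]) \<noteq> []"
      by (simp add: vs)
  qed
  moreover have "fst ` set (zip vs (ws @ [u])) = pverts G"
    using fst_zip set by (metis list.set_map)
  moreover have "3 \<le> length (zip vs (ws @ [u]))"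
    using length by (simp add: vs)
  ultimately show ?thesis
    unfolding hamiltonian_def by blast
qed

text \<open>\<open>F\<close> is the arc set of the cycle. Injectivity of \<open>snd\<close> reflects
  that the heads do not repeat; the closure property reflects that following successors from any
  vertex reaches all of them.\<close>

lemma hamiltonianE:
  assumes "hamiltonian G"
  obtains F where "finite F" and "F \<subseteq> parcs G" and "fst ` F = pverts G" and "inj_on snd F"
    and "\<And>X. F `` X \<subseteq> X \<Longrightarrow> X \<inter> pverts G \<noteq> {} \<Longrightarrow> pverts G \<subseteq> X"
proof -
  obtain p u where sub: "set p \<subseteq> parcs G" and cas: "pcas u p u"
    and distinct: "distinct (tl (pawalk_verts u p))" and fst: "fst ` set p = pverts G"
    using assms unfolding hamiltonian_def pre_digraph.cycle_def pre_digraph.awalk_def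
    by (auto simp only: cas_with_proj_eq awalk_verts_with_proj_eq with_proj_simps)
  have verts: "pawalk_verts x p = x # map snd p" if "pcas x p y" for x y :: 'a and p
    using that by (induction p arbitrary: x) auto
  have closed: "v \<in> X \<and> fst ` set q \<subseteq> X"
    if "pcas x q v" "set q `` X \<subseteq> X" "x \<in> X" for q x v and X :: "'a set"
    using that
  proof (induction q arbitrary: x)
    case (Cons e q)
    then obtain y where e: "e = (x, y)" and q: "pcas y q v"
      by (cases e) simp
    have "y \<in> X"
      by (rule subsetD[OF Cons.prems(2)], rule ImageI[of x]) (use Cons.prems(3) e in simp_all)
    moreover have "set q `` X \<subseteq> X"
      by (rule order_trans[OF Image_mono[OF _ subset_refl] Cons.prems(2)]) auto
    ultimately show ?case
      using Cons.IH[OF q] Cons.prems(3) e by simp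
  qed simp
  show ?thesis
  proof
    show "finite (set p)" "set p \<subseteq> parcs G" "fst ` set p = pverts G"
      by (simp_all add: sub fst)
    show "inj_on snd (set p)"
      using distinct verts[OF cas] by (simp add: distinct_map)
  next
    fix X assume X: "set p `` X \<subseteq> X" "X \<inter> pverts G \<noteq> {}"
    then obtain x where "x \<in> X" "x \<in> fst ` set p"
      using fst by auto
    then obtain e where e: "e \<in> set p" "fst e \<in> X"
      by auto
    then obtain q r where p: "p = q @ e # r"
      by (meson split_list)
    have append: "pcas x (q @ r) y \<longleftrightarrow> (\<exists>z. pcas x q z \<and> pcas z r y)" for x y :: 'a and q r
      by (induction q arbitrary: x) auto
    \<comment> \<open>The walk is followed from an arc that starts in \<open>X\<close> to its end
      \<open>u\<close>, and then once around from \<open>u\<close>.\<close>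
    have "pcas (fst e) (e # r) u"
      using cas by (auto simp: p append)
    moreover have "set (e # r) `` X \<subseteq> X"
      using X(1) by (auto simp: p)
    ultimately have "u \<in> X"
      using closed e(2) by blast
    with closed[OF cas X(1)] show "pverts G \<subseteq> X"
      using fst by simp
  qed
qed

text \<open>Passing from a vertex of \<open>I\<close> to its successor on the cycle is injective
  into \<open>T\<close>.\<close>

lemma hamiltonian_card_le:
  assumes "hamiltonian G" and "finite T" and "I \<subseteq> pverts G"
    and "\<And>u v. (u, v) \<in> parcs G \<Longrightarrow> u \<in> I \<Longrightarrow> v \<in> T"
  shows "card I \<le> card T"
proof -
  obtain F where F: "finite F" "F \<subseteq> parcs G" "fst ` F = pverts G" "inj_on snd F"
    using assms(1) by (rule hamiltonianE)
  define E where "E = {e \<in> F. fst e \<in> I}"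
  have "I = fst ` E"
    using F(3) assms(3) by (auto simp: E_def)
  moreover have "finite E"
    using F(1) by (simp add: E_def)
  ultimately have "card I \<le> card E"
    by (metis card_image_le)
  also have "\<dots> \<le> card T"
    using assms(2,4) F(2,4) by (intro card_inj_on_le[of snd]) (auto simp: E_def inj_on_def)
  finally show ?thesis .
qed

text \<open>The successors of \<open>I\<close> are distinct elements of \<open>T\<close>. The cycle
  must also leave \<open>S\<close>, and the arc by which it does so ends in \<open>T\<close>, at a
  vertex different from all those successors.\<close>

lemma hamiltonian_card_less:
  assumes "hamiltonian G" and "finite T" and "I \<subseteq> pverts G" and "S \<subseteq> pverts G"
    and "S \<noteq> {}" and "S \<noteq> pverts G" and "S \<inter> I = {}"
    and I: "\<And>u v. (u, v) \<in> parcs G \<Longrightarrow> u \<in> I \<Longrightarrow> v \<in> T"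
    and S: "\<And>u v. (u, v) \<in> parcs G \<Longrightarrow> u \<in> S \<Longrightarrow> v \<in> S \<union> T"
  shows "card I < card T"
proof -
  obtain F where F: "finite F" "F \<subseteq> parcs G" "fst ` F = pverts G" "inj_on snd F"
    and closed: "\<And>X. F `` X \<subseteq> X \<Longrightarrow> X \<inter> pverts G \<noteq> {} \<Longrightarrow> pverts G \<subseteq> X"
    using assms(1) by (rule hamiltonianE) blast
  have "\<not> F `` S \<subseteq> S"
    using closed[of S] assms(4-6) by blast
  then obtain c b where cb: "(c, b) \<in> F" "c \<in> S" "b \<notin> S"
    by blast
  define E where "E = {e \<in> F. fst e \<in> I}"
  have "I = fst ` E"
    using F(3) assms(3) by (auto simp: E_def)
  moreover have "finite E"
    using F(1) by (simp add: E_def)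
  ultimately have "card I \<le> card E"
    by (metis card_image_le)
  also have "\<dots> < card (insert (c, b) E)"
    using F(1) cb(2) assms(7) by (subst card_insert_disjoint) (auto simp: E_def)
  also have "\<dots> \<le> card T"
  proof (rule card_inj_on_le[of snd])
    show "inj_on snd (insert (c, b) E)"
      by (rule inj_on_subset[OF F(4)]) (use cb(1) in \<open>auto simp: E_def\<close>)
    have "snd e \<in> T" if "e \<in> E" for e
      using I[of "fst e" "snd e"] F(2) that by (auto simp: E_def)
    moreover have "b \<in> T"
      using S[of c b] F(2) cb by auto
    ultimately show "snd ` insert (c, b) E \<subseteq> T"
      by auto
  qed (fact assms(2))
  finally show ?thesis .
qed

section \<open>The double vertex graph of a fan graph\<close>

lemma pverts_fan [simp]: "pverts (fan_graph m n) = {..<m} <+> {..<n}"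
  by (simp add: fan_graph_def graph_join_def edgeless_graph_def path_graph_def)

lemma parcs_fan:
  "(Inl i, Inl k) \<notin> parcs (fan_graph m n)"
  "(Inl i, Inr j) \<in> parcs (fan_graph m n) \<longleftrightarrow> i < m \<and> j < n"
  "(Inr j, Inl i) \<in> parcs (fan_graph m n) \<longleftrightarrow> i < m \<and> j < n"
  "(Inr j, Inr l) \<in> parcs (fan_graph m n) \<longleftrightarrow> j < n \<and> l < n \<and> (j = Suc l \<or> l = Suc j)"
  by (auto simp: fan_graph_def graph_join_def edgeless_graph_def path_graph_def)

lemma fan_arcD:
  assumes "(u, v) \<in> parcs (fan_graph m n)"
  shows "(v, u) \<in> parcs (fan_graph m n)" and "u \<noteq> v"
    and "u \<in> {..<m} <+> {..<n}" and "v \<in> {..<m} <+> {..<n}"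
  using assms by (cases u; cases v; force simp: parcs_fan)+

definition pairs_A :: "nat \<Rightarrow> (nat + nat) set set" where
  "pairs_A m = {X. X \<subseteq> Inl ` {..<m} \<and> card X = 2}"

definition pairs_B :: "nat \<Rightarrow> nat \<Rightarrow> (nat + nat) set set" where
  "pairs_B m n = (\<lambda>(i, j). {Inl i, Inr j}) ` ({..<m} \<times> {..<n})"

definition pairs_C :: "nat \<Rightarrow> (nat + nat) set set" where
  "pairs_C n = {X. X \<subseteq> Inr ` {..<n} \<and> card X = 2}"

lemma pairs_A_iff: "X \<in> pairs_A m \<longleftrightarrow> (\<exists>i k. i < k \<and> k < m \<and> X = {Inl i, Inl k})"
proof
  assume "X \<in> pairs_A m"
  then obtain x y where "X = {x, y}" "x \<noteq> y" "x \<in> Inl ` {..<m}" "y \<in> Inl ` {..<m}"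
    by (auto simp: pairs_A_def card_2_iff)
  then obtain i k where "i \<noteq> k" "i < m" "k < m" "X = {Inl i, Inl k}"
    by auto
  then have "min i k < max i k" "max i k < m" "X = {Inl (min i k), Inl (max i k)}"
    by (auto simp: min_def max_def)
  then show "\<exists>i k. i < k \<and> k < m \<and> X = {Inl i, Inl k}"
    by blast
qed (auto simp: pairs_A_def)

lemma pairs_C_iff: "X \<in> pairs_C n \<longleftrightarrow> (\<exists>j l. j < l \<and> l < n \<and> X = {Inr j, Inr l})"
proof
  assume "X \<in> pairs_C n"
  then obtain x y where "X = {x, y}" "x \<noteq> y" "x \<in> Inr ` {..<n}" "y \<in> Inr ` {..<n}"
    by (auto simp: pairs_C_def card_2_iff)
  then obtain j l where "j \<noteq> l" "j < n" "l < n" "X = {Inr j, Inr l}"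
    by auto
  then have "min j l < max j l" "max j l < n" "X = {Inr (min j l), Inr (max j l)}"
    by (auto simp: min_def max_def)
  then show "\<exists>j l. j < l \<and> l < n \<and> X = {Inr j, Inr l}"
    by blast
qed (auto simp: pairs_C_def)

lemma pairs_B_iff: "X \<in> pairs_B m n \<longleftrightarrow> (\<exists>i j. i < m \<and> j < n \<and> X = {Inl i, Inr j})"
  by (auto simp: pairs_B_def)

lemma pverts_double_fan:
  "pverts (double_vertex_graph (fan_graph m n)) = pairs_A m \<union> pairs_B m n \<union> pairs_C n"
proof (intro equalityI subsetI)
  fix X assume "X \<in> pverts (double_vertex_graph (fan_graph m n))"
  then obtain x y where X: "X = {x, y}" "x \<noteq> y" "x \<in> {..<m} <+> {..<n}" "y \<in> {..<m} <+> {..<n}"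
    by (auto simp: token_graph_def card_2_iff)
  then show "X \<in> pairs_A m \<union> pairs_B m n \<union> pairs_C n"
    by (auto simp: pairs_A_def pairs_C_def pairs_B_iff insert_commute)
qed (auto simp: token_graph_def pairs_A_iff pairs_B_iff pairs_C_iff)

lemma card_pairs:
  shows "card (pairs_A m) = m choose 2" and "card (pairs_B m n) = m * n" and "finite (pairs_A m)"
    and "finite (pairs_B m n)"
proof -
  show "card (pairs_A m) = m choose 2"
    unfolding pairs_A_def by (subst n_subsets) (simp_all add: card_image)
  show "card (pairs_B m n) = m * n"
    unfolding pairs_B_def
    by (subst card_image) (auto simp: inj_on_def doubleton_eq_iff)
qed (auto simp: pairs_A_def pairs_B_def)

text \<open>One token \<open>w\<close> stays in place: the pairs have equal size and their symmetric
  difference has two elements, so each difference is a singleton.\<close>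

lemma double_fan_arc:
  assumes "(X, Y) \<in> parcs (double_vertex_graph (fan_graph m n))"
  obtains w u v where "X = {w, u}" "Y = {w, v}" "w \<noteq> u" "w \<noteq> v" "(u, v) \<in> parcs (fan_graph m n)"
    "w \<in> pverts (fan_graph m n)"
proof -
  obtain u v where X: "X \<subseteq> pverts (fan_graph m n)" "card X = 2" and Y: "card Y = 2"
    and uv: "(u, v) \<in> parcs (fan_graph m n)" and XY: "(X - Y) \<union> (Y - X) = {u, v}"
    using assms by (auto simp: token_graph_def Let_def)
  have vu: "(v, u) \<in> parcs (fan_graph m n)" and "u \<noteq> v"
    using fan_arcD[OF uv] by simp_all
  have fin: "finite X" "finite Y"
    using X Y by (auto intro: card_ge_0_finite)
  have card_diff: "card (X - Y) = card (Y - X)"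
    using card_Diff_subset_Int[of X Y] card_Diff_subset_Int[of Y X] fin X Y by (simp add: Int_commute)
  have "card (X - Y) + card (Y - X) = 2"
    using card_Un_disjoint[of "X - Y" "Y - X"] fin \<open>u \<noteq> v\<close> by (simp add: XY disjoint_iff)
  then have "card (X - Y) = 1" "card (Y - X) = 1"
    using card_diff by auto
  then obtain a b where ab: "X - Y = {a}" "Y - X = {b}"
    by (auto simp: card_1_singleton_iff)
  have "card (X \<inter> Y) = 1"
    using card_Diff_subset_Int[of X Y] fin X ab by simp
  then obtain w where w: "X \<inter> Y = {w}"
    by (auto simp: card_1_singleton_iff)
  \<comment> \<open>Only the unordered pair is determined; the symmetry of the arcs supplies the
    orientation.\<close>
  have "{a, b} = {u, v}"
    using XY ab by (simp add: insert_commute)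
  then have "(a, b) \<in> parcs (fan_graph m n)"
    using uv vu by (auto simp: doubleton_eq_iff)
  moreover have "X = {w, a}" "Y = {w, b}" "w \<noteq> a" "w \<noteq> b"
    using ab w Un_Diff_Int[of X Y] Un_Diff_Int[of Y X] by (auto simp: Int_commute)
  moreover have "w \<in> pverts (fan_graph m n)"
    using w X by blast
  ultimately show ?thesis
    by (intro that)
qed

lemma arc_from_A:
  assumes "(X, Y) \<in> parcs (double_vertex_graph (fan_graph m n))" and "X \<in> pairs_A m"
  shows "Y \<in> pairs_B m n"
  using assms(1)
proof (rule double_fan_arc)
  fix w u v assume *: "X = {w, u}" "Y = {w, v}" "(u, v) \<in> parcs (fan_graph m n)"
  with assms(2) obtain i k where "w = Inl i" "u = Inl k" "i < m"
    by (auto simp: pairs_A_iff doubleton_eq_iff)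
  with * show ?thesis
    by (cases v) (auto simp: parcs_fan pairs_B_iff)
qed

lemma arc_from_C:
  assumes "(X, Y) \<in> parcs (double_vertex_graph (fan_graph m n))" and "X \<in> pairs_C n"
  shows "Y \<in> pairs_C n \<union> pairs_B m n"
  using assms(1)
proof (rule double_fan_arc)
  fix w u v
  assume *: "X = {w, u}" "Y = {w, v}" "(u, v) \<in> parcs (fan_graph m n)" "w \<noteq> v"
  with assms(2) obtain j l where "w = Inr j" "u = Inr l" "j < n"
    by (auto simp: pairs_C_iff doubleton_eq_iff)
  with * show ?thesis
    by (cases v) (auto simp: parcs_fan pairs_B_iff pairs_C_def)
qed

text \<open>The token on \<open>Inl i\<close> is blocked, since its only neighbour
  \<open>Inr 0\<close> is occupied; so the other token moves.\<close>

lemma arc_from_B_one: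
  assumes "(X, Y) \<in> parcs (double_vertex_graph (fan_graph m 1))" and "X \<in> pairs_B m 1"
  shows "Y \<in> pairs_A m"
  using assms(1)
proof (rule double_fan_arc)
  fix w u v
  assume *: "X = {w, u}" "Y = {w, v}" "(u, v) \<in> parcs (fan_graph m 1)" "w \<noteq> v"
  with assms(2) obtain i where "i < m" "(w, u) = (Inl i, Inr 0) \<or> (w, u) = (Inr 0, Inl i)"
    by (auto simp: pairs_B_iff doubleton_eq_iff)
  with * show ?thesis
    by (cases v) (auto simp: parcs_fan pairs_A_def)
qed

section \<open>Necessity of the conditions on \<open>m\<close>\<close>

lemma hamiltonian_double_fan_one:
  assumes "hamiltonian (double_vertex_graph (fan_graph m 1))" and "1 \<le> m"
  shows "m = 3"
proof -
  have "card (pairs_A m) \<le> card (pairs_B m 1)"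
    using assms(1) by (rule hamiltonian_card_le)
      (auto simp: card_pairs pverts_double_fan dest: arc_from_A)
  moreover have "card (pairs_B m 1) \<le> card (pairs_A m)"
    using assms(1) by (rule hamiltonian_card_le)
      (use arc_from_B_one in \<open>auto simp: card_pairs pverts_double_fan\<close>)
  ultimately have "m * (m - 1) div 2 = m"
    by (simp add: card_pairs choose_two)
  \<comment> \<open>Parity makes the truncated division by 2 exact.\<close>
  moreover have "even (m * (m - 1))"
    by (cases m) auto
  ultimately have "m * (m - 1) = m * 2"
    by (metis dvd_div_mult_self)
  with assms(2) show ?thesis
    by auto
qed

text \<open>The strict inequality comes from the pairs of type C, a set that the cycle has to leave;
  \<open>m (m - 1) / 2 \<le> m n\<close> would still admit \<open>m = 2 n + 1\<close>.\<close>

lemma hamiltonian_double_fan_bound: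
  assumes "hamiltonian (double_vertex_graph (fan_graph m n))" and "1 \<le> m" and "2 \<le> n"
  shows "m \<le> 2 * n"
proof -
  have "card (pairs_A m) < card (pairs_B m n)"
    using assms(1)
  proof (rule hamiltonian_card_less[where S = "pairs_C n"])
    have "{Inr 0, Inr 1} \<in> pairs_C n"
      using assms(3) by (auto simp: pairs_C_def)
    then show "pairs_C n \<noteq> {}"
      by blast
    have "{Inl 0, Inr 0} \<in> pairs_B m n"
      using assms(2,3) by (force simp: pairs_B_def)
    moreover have "{Inl 0, Inr 0} \<notin> pairs_C n"
      by (auto simp: pairs_C_def)
    ultimately show "pairs_C n \<noteq> pverts (double_vertex_graph (fan_graph m n))"
      by (auto simp: pverts_double_fan)
    show "pairs_C n \<inter> pairs_A m = {}"
      by (auto simp: pairs_C_iff pairs_A_iff doubleton_eq_iff)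
  qed (auto simp: card_pairs pverts_double_fan dest: arc_from_A arc_from_C)
  then have "m * (m - 1) div 2 < m * n"
    by (simp add: card_pairs choose_two)
  then have "m * (m - 1) < m * (2 * n)"
    by (simp add: div_less_iff_less_mult mult_ac)
  then show ?thesis
    by auto
qed

section \<open>The Hamiltonian cycle\<close>

lemma successively_concat_map_upt:
  assumes "\<And>i. i < n \<Longrightarrow> f i \<noteq> [] \<and> successively P (f i)"
    and "\<And>i. Suc i < n \<Longrightarrow> P (last (f i)) (hd (f (Suc i)))"
  shows "successively P (concat (map f [0..<n]))"
    and "0 < n \<Longrightarrow> last (concat (map f [0..<n])) = last (f (n - 1))"
    and "0 < n \<Longrightarrow> hd (concat (map f [0..<n])) = hd (f 0)"
proof -
  \<comment> \<open>Stated for every initial segment, as the induction below needs it.\<close>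
  have last: "last (concat (map f [0..<k])) = last (f (k - 1))" if "0 < k" "k \<le> n" for k
    using that assms(1) by (cases k) auto
  then show "0 < n \<Longrightarrow> last (concat (map f [0..<n])) = last (f (n - 1))"
    by simp
  have "successively P (concat (map f [0..<k]))" if "k \<le> n" for k
    using that
  proof (induction k)
    case (Suc k)
    then show ?case
      using assms(1)[of k] assms(2)[of "k - 1"] last[of k]
      by (cases "k = 0") (simp_all add: successively_append_iff)
  qed simp
  then show "successively P (concat (map f [0..<n]))"
    by simp
  show "0 < n \<Longrightarrow> hd (concat (map f [0..<n])) = hd (f 0)"
    using assms(1)[of 0] by (subst upt_conv_Cons) auto
qed

lemma distinct_concat_map_upt:
  assumes "\<And>i. i < n \<Longrightarrow> distinct (f i)"
    and "\<And>i j x. i < n \<Longrightarrow> j < n \<Longrightarrow> x \<in> set (f i) \<Longrightarrow> x \<in> set (f j) \<Longrightarrow> i = j"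
  shows "distinct (concat (map f [0..<n]))"
  using assms
proof (induction n)
  case (Suc n)
  have "distinct (concat (map f [0..<n]))"
    using Suc.prems by (intro Suc.IH) (auto intro: less_SucI)
  moreover have "set (f i) \<inter> set (f n) = {}" if "i < n" for i
    using Suc.prems(2)[of i n] that by fastforce
  ultimately show ?case
    using Suc.prems(1) by fastforce
qed simp

text \<open>Column \<open>c\<close> of row \<open>r\<close> receives the edge of the tournament between \<open>r\<close> and \<open>r - (c + 1)\<close>, taken
  modulo \<open>2 n - 1\<close> in \<open>{1..2 n - 1}\<close>.\<close>

definition partner :: "nat \<Rightarrow> nat \<Rightarrow> nat \<Rightarrow> nat" where
  "partner n r c =
    (if c = 0 \<and> 2 \<le> r then 0 else if Suc c < r then r - Suc c else 2 * n + r - Suc (Suc c))"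

text \<open>The pairs visited right after \<open>{Inl r, Inr c}\<close>. In row 0 the index
  \<open>d\<close> runs downwards, so that the last pair \<open>{Inr c, Inr (Suc c)}\<close> is
  adjacent to \<open>{Inl 0, Inr (Suc c)}\<close>; for \<open>c = 0\<close> the value
  \<open>n - 1\<close> is left out, because the pair of the two ends closes the tour.\<close>

definition gap :: "nat \<Rightarrow> nat \<Rightarrow> nat \<Rightarrow> nat \<Rightarrow> (nat + nat) set list" where
  "gap m n r c =
    (if Suc c = n then [if Suc r < m then {Inl r, Inl (Suc r)} else {Inr 0, Inr c}]
     else if r = 0 then map (\<lambda>d. {Inr c, Inr d}) (rev [Suc c..<(if c = 0 then n - 1 else n)])
     else if partner n r c < m then [{Inl r, Inl (partner n r c)}]
     else [])"

definition block :: "nat \<Rightarrow> nat \<Rightarrow> nat \<Rightarrow> nat \<Rightarrow> (nat + nat) set list" where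
  "block m n r c = {Inl r, Inr c} # gap m n r c"

definition row :: "nat \<Rightarrow> nat \<Rightarrow> nat \<Rightarrow> (nat + nat) set list" where
  "row m n r = concat (map (block m n r) [0..<n])"

definition tour :: "nat \<Rightarrow> nat \<Rightarrow> (nat + nat) set list" where
  "tour m n = concat (map (row m n) [0..<m])"

section \<open>Entries of the gaps and arithmetic of the tournament\<close>

lemma partner_neq: "r < m \<Longrightarrow> m \<le> 2 * n \<Longrightarrow> Suc c < n \<Longrightarrow> partner n r c \<noteq> r"
  by (auto simp: partner_def)

text \<open>The kinds of inserted pairs: link to the next row, closing pair, other pair of type C,
  tournament pair.\<close>

lemma mem_gap_cases:
  assumes "X \<in> set (gap m n r c)" and "r < m" and "c < n" and "2 \<le> n"
  obtains
    "Suc c = n" "Suc r < m" "X = {Inl r, Inl (Suc r)}"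
  | "Suc c = n" "Suc r = m" "X = {Inr 0, Inr (n - 1)}"
  | d where "r = 0" "c < d" "d < n" "c \<noteq> 0 \<or> d \<noteq> n - 1" "X = {Inr c, Inr d}"
  | "Suc c < n" "0 < r" "partner n r c < m" "X = {Inl r, Inl (partner n r c)}"
proof -
  consider "Suc c = n" | "Suc c < n" "r = 0" | "Suc c < n" "0 < r"
    using assms(3) by linarith
  then show ?thesis
  proof cases
    case 2
    then have "X \<in> (\<lambda>d. {Inr c, Inr d}) ` {Suc c..<(if c = 0 then n - 1 else n)}"
      using assms(1) by (simp add: gap_def split: if_splits)
    then obtain d where d: "X = {Inr c, Inr d}" "Suc c \<le> d" "d < (if c = 0 then n - 1 else n)"
      by (elim imageE) simp
    then have "d < n" "c \<noteq> 0 \<or> d \<noteq> n - 1"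
      by (auto split: if_splits)
    with 2 d show ?thesis
      by (intro that(3)[of d]) simp_all
  qed (use assms that in \<open>auto simp: gap_def split: if_splits\<close>)
qed

text \<open>The replaced pair with 0, the difference without wrap-around modulo
  \<open>2 n - 1\<close>, and the one with it. The equations avoid truncated subtraction and so suit
  linear arithmetic.\<close>

lemma partner_cases:
  assumes "Suc c < n" and "0 < r"
  obtains "c = 0" and "2 \<le> r" and "partner n r c = 0"
  | "0 < c" and "0 < partner n r c" and "partner n r c + Suc c = r"
  | "r \<le> Suc c" and "partner n r c + Suc (Suc c) = 2 * n + r"
proof -
  consider "c = 0" "2 \<le> r" | "0 < c" "Suc c < r" | "r \<le> Suc c"
    by linarith
  then show ?thesis
  proof cases
    case 3
    with assms show ?thesis
      by (intro that(3)) (auto simp: partner_def)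
  qed (use that in \<open>auto simp: partner_def\<close>)
qed

text \<open>Apart from the partner 0, which occurs only in column 0, the difference of
  \<open>r\<close> and its partner modulo \<open>2 n - 1\<close> is \<open>c + 1\<close>, which lies
  between 1 and \<open>n - 1\<close> and thus fixes both the column and the direction.\<close>

lemma partner_inj:
  assumes "Suc c < n" and "Suc c' < n" and "0 < r" and "0 < r'" and "r < 2 * n" and "r' < 2 * n"
    and "{r, partner n r c} = {r', partner n r' c'}"
  shows "r = r' \<and> c = c'"
proof -
  consider "r = r'" "partner n r c = partner n r c'" | "r = partner n r' c'" "r' = partner n r c"
    using assms(7) by (auto simp: doubleton_eq_iff)
  then show ?thesis
  proof cases
    case 1
    have "c = c'"
      using assms(1,3) by (cases rule: partner_cases; cases rule: partner_cases[OF assms(2,3)])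
        (use assms 1 in linarith)+
    with 1 show ?thesis
      by simp
  next
    case 2
    \<comment> \<open>Opposite differences would give \<open>(c + 1) + (c' + 1)\<close> divisible by
      \<open>2 n - 1\<close>, but this sum lies between 2 and \<open>2 n - 2\<close>. The partner 0
      is excluded because \<open>r\<close> and \<open>r'\<close> are positive.\<close>
    have False
      using assms(1,3) by (cases rule: partner_cases; cases rule: partner_cases[OF assms(2,4)])
        (use assms(1-6) 2 in linarith)+
    then show ?thesis ..
  qed
qed

text \<open>Such pairs already link the rows. Without wrap-around, difference 1 would need
  \<open>c = 0\<close>, where the partner is 0 and \<open>2 \<le> r\<close>; with wrap-around the
  partner exceeds \<open>r\<close> by at least \<open>n\<close>.\<close>

lemma partner_neq_Suc:
  assumes "Suc c < n" and "0 < r" and "Suc i < 2 * n"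
  shows "{r, partner n r c} \<noteq> {i, Suc i}"
proof
  assume "{r, partner n r c} = {i, Suc i}"
  then consider "r = i" "partner n r c = Suc i" | "r = Suc i" "partner n r c = i"
    by (auto simp: doubleton_eq_iff)
  then show False
    by cases (use assms(1,2) in \<open>cases rule: partner_cases; use assms in linarith\<close>)+
qed

text \<open>A pair with 0 belongs to column 0 of row \<open>k\<close>. Otherwise the pair belongs to
  row \<open>k\<close> if the difference \<open>k - i\<close> is less than \<open>n\<close>, and to
  row \<open>i\<close>, by wrap-around, if not.\<close>

lemma partner_surj:
  assumes "i < k" and "k \<noteq> Suc i" and "k < m" and "m \<le> 2 * n" and "2 \<le> n"
  obtains r c where "0 < r" and "r < m" and "Suc c < n" and "{r, partner n r c} = {i, k}"
proof -
  consider "i = 0" | "0 < i" "k - i < n" | "0 < i" "n \<le> k - i"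
    by linarith
  then show ?thesis
  proof cases
    case 1
    then have "partner n k 0 = i"
      using assms by (auto simp: partner_def)
    then show ?thesis
      using assms by (intro that[of k 0]) auto
  next
    case 2
    obtain c where c: "k = Suc (i + c)"
      using assms(1) less_iff_Suc_add by blast
    then have "partner n k c = i"
      using assms(2) 2(1) by (simp add: partner_def)
    then show ?thesis
      using assms(3) 2 c by (intro that[of k c]) auto
  next
    case 3
    \<comment> \<open>The wrap-around equation solved for the column; \<open>k < 2 n\<close> and
      \<open>0 < i\<close> keep the subtraction exact.\<close>
    define c where "c = 2 * n + i - Suc (Suc k)"
    have c: "k + Suc (Suc c) = 2 * n + i"
      unfolding c_def using assms(3,4) 3(1) by linarith
    have "\<not> (c = 0 \<and> 2 \<le> i)" "\<not> Suc c < i"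
      using c assms(3,4) by linarith+
    moreover have "2 * n + i - Suc (Suc c) = k"
      using c by linarith
    ultimately have "partner n i c = k"
      unfolding partner_def by simp
    moreover have "Suc c < n" "i < m"
      using c 3 assms by linarith+
    ultimately show ?thesis
      using 3(1) by (intro that[of i c]) simp_all
  qed
qed

text \<open>Pairs of types A and C never coincide. Within type A, \<open>partner_neq_Suc\<close>
  separates links from tournament pairs, and \<open>partner_inj\<close> separates the latter from
  each other.\<close>

lemma mem_gap_unique:
  assumes X: "X \<in> set (gap m n r c)" "X \<in> set (gap m n r' c')" and n: "2 \<le> n" and m: "m \<le> 2 * n"
    and r: "r < m" "c < n" and r': "r' < m" "c' < n"
  shows "r = r' \<and> c = c'"
proof -
  have Inl_eq: "{Inl a, Inl b} = {Inl a', Inl b' :: nat + nat} \<longleftrightarrow> {a, b} = {a', b'}" for a b a' b'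
    by (simp add: doubleton_eq_iff)
  show ?thesis
    using X(1) r n
  proof (cases rule: mem_gap_cases)
    case 1
    show ?thesis
      using X(2) r' n
    proof (cases rule: mem_gap_cases)
      case 4
      with 1 r' m partner_neq_Suc[of c' n r' r] show ?thesis
        by (simp add: Inl_eq)
    qed (use 1 in \<open>auto simp: doubleton_eq_iff\<close>)
  next
    case 2
    show ?thesis
      using X(2) r' n by (cases rule: mem_gap_cases) (use 2 in \<open>auto simp: doubleton_eq_iff\<close>)
  next
    case 3
    show ?thesis
      using X(2) r' n by (cases rule: mem_gap_cases) (use 3 in \<open>auto simp: doubleton_eq_iff\<close>)
  next
    case 4
    show ?thesis
      using X(2) r' n
    proof (cases rule: mem_gap_cases)
      case 1
      with 4 r m partner_neq_Suc[of c n r r'] show ?thesis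
        by (simp add: Inl_eq)
    next
      case both: 4
      with 4 r r' m partner_inj[of c n c' r r'] show ?thesis
        by (simp add: Inl_eq)
    qed (use 4 in \<open>auto simp: doubleton_eq_iff\<close>)
  qed
qed

section \<open>The tour visits every pair exactly once\<close>

lemma mixed_not_in_gap:
  assumes "r < m" and "c < n" and "2 \<le> n"
  shows "{Inl i, Inr j} \<notin> set (gap m n r c)"
proof
  assume "{Inl i, Inr j} \<in> set (gap m n r c)"
  then show False
    using assms by (cases rule: mem_gap_cases) (auto simp: doubleton_eq_iff)
qed

text \<open>Row and column are recovered together, which serves both for distinctness inside a row
  and for disjointness of the rows.\<close>

lemma mem_block_unique:
  assumes "X \<in> set (block m n r c)" and "X \<in> set (block m n r' c')" and "2 \<le> n" and "m \<le> 2 * n"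
    and "r < m" "c < n" "r' < m" "c' < n"
  shows "r = r' \<and> c = c'"
proof (cases "X \<in> set (gap m n r c) \<and> X \<in> set (gap m n r' c')")
  case True
  then show ?thesis
    using assms by (intro mem_gap_unique[of X]) auto
next
  case False
  moreover have "{Inl r, Inr c} \<notin> set (gap m n r' c')" "{Inl r', Inr c'} \<notin> set (gap m n r c)"
    using assms by (simp_all add: mixed_not_in_gap)
  moreover have "X = {Inl r, Inr c} \<or> X \<in> set (gap m n r c)"
    "X = {Inl r', Inr c'} \<or> X \<in> set (gap m n r' c')"
    using assms(1,2) by (simp_all add: block_def)
  ultimately have "{Inl r, Inr c} = {Inl r', Inr c' :: nat + nat}"
    by blast
  then show ?thesis
    by (simp add: doubleton_eq_iff)
qed

lemma distinct_tour:
  assumes "2 \<le> n" and "m \<le> 2 * n"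
  shows "distinct (tour m n)"
  unfolding tour_def
proof (rule distinct_concat_map_upt)
  fix r assume r: "r < m"
  have "distinct (block m n r c)" if "c < n" for c
  proof -
    have "{Inl r, Inr c} \<notin> set (gap m n r c)"
      using r that assms(1) by (rule mixed_not_in_gap)
    moreover have "distinct (gap m n r c)"
      by (auto simp: gap_def distinct_map inj_on_def doubleton_eq_iff)
    ultimately show ?thesis
      by (simp add: block_def)
  qed
  then show "distinct (row m n r)"
    unfolding row_def using mem_block_unique[OF _ _ assms r _ r]
    by (intro distinct_concat_map_upt) auto
next
  fix r r' X assume "r < m" "r' < m" "X \<in> set (row m n r)" "X \<in> set (row m n r')"
  then show "r = r'"
    using mem_block_unique[OF _ _ assms] by (auto simp: row_def)
qed

lemma set_tour:
  assumes n: "2 \<le> n" and m: "1 \<le> m" "m \<le> 2 * n"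
  shows "set (tour m n) = pairs_A m \<union> pairs_B m n \<union> pairs_C n"
proof (intro equalityI subsetI)
  fix X assume "X \<in> set (tour m n)"
  then obtain r c where r: "r < m" and c: "c < n" and X: "X \<in> set (block m n r c)"
    by (auto simp: tour_def row_def)
  show "X \<in> pairs_A m \<union> pairs_B m n \<union> pairs_C n"
  proof (cases "X = {Inl r, Inr c}")
    case True
    with r c show ?thesis
      by (auto simp: pairs_B_iff)
  next
    case False
    then have "X \<in> set (gap m n r c)"
      using X by (simp add: block_def)
    then show ?thesis
      using n r c partner_neq[OF r m(2), of c]
      by (elim mem_gap_cases) (auto simp: pairs_A_def pairs_C_def)
  qed
next
  fix X assume "X \<in> pairs_A m \<union> pairs_B m n \<union> pairs_C n"
  then consider
    i k where "i < k" "k < m" "X = {Inl i, Inl k}"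
  | i j where "i < m" "j < n" "X = {Inl i, Inr j}"
  | j l where "j < l" "l < n" "X = {Inr j, Inr l}"
    by (auto simp: pairs_A_iff pairs_B_iff pairs_C_iff)
  then have "\<exists>r<m. \<exists>c<n. X \<in> set (block m n r c)"
  proof cases
    case 1
    show ?thesis
    proof (cases "k = Suc i")
      case True
      with 1 n have "i < m" "X \<in> set (block m n i (n - 1))"
        by (auto simp: block_def gap_def)
      with n show ?thesis
        by (intro exI[of _ i] conjI exI[of _ "n - 1"]) auto
    next
      case False
      obtain r c where rc: "0 < r" "r < m" "Suc c < n" "{r, partner n r c} = {i, k}"
        using partner_surj[OF 1(1) False 1(2) m(2) n] by metis
      \<comment> \<open>The partner is \<open>i\<close> or \<open>k\<close>, hence below
        \<open>m\<close>, so \<open>gap\<close> does not drop the pair.\<close>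
      then have "X = {Inl r, Inl (partner n r c)}" "partner n r c < m"
        using 1 by (auto simp: doubleton_eq_iff)
      with rc have "X \<in> set (block m n r c)"
        by (simp add: block_def gap_def)
      with rc show ?thesis
        by (intro exI[of _ r] conjI exI[of _ c]) auto
    qed
  next
    case 2
    then show ?thesis
      by (intro exI[of _ i] conjI exI[of _ j]) (simp_all add: block_def)
  next
    case 3
    show ?thesis
    proof (cases "j = 0 \<and> l = n - 1")
      case True
      with 3 have "Suc l = n"
        by simp
      \<comment> \<open>The pair of the two ends stands in the last column of the last row
        \<open>m - 1\<close>.\<close>
      with True 3 m show ?thesis
        by (intro exI[of _ "m - 1"] conjI exI[of _ l]) (simp_all add: block_def gap_def)
    next
      case False
      with 3 have "l \<in> set (rev [Suc j..<(if j = 0 then n - 1 else n)])" "Suc j \<noteq> n"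
        by auto
      with 3 have "X \<in> set (gap m n 0 j)"
        unfolding gap_def by (simp only: if_False if_True refl set_map) blast
      with 3 m show ?thesis
        by (intro exI[of _ 0] conjI exI[of _ j]) (simp_all add: block_def)
    qed
  qed
  then show "X \<in> set (tour m n)"
    by (fastforce simp: tour_def row_def)
qed

section \<open>Consecutive pairs of the tour are adjacent\<close>

lemma double_fan_arcI:
  assumes "(u, v) \<in> parcs (fan_graph m n)" and "w \<in> {..<m} <+> {..<n}" and "w \<noteq> u" and "w \<noteq> v"
    and "X = {w, u}" and "Y = {w, v}"
  shows "(X, Y) \<in> parcs (double_vertex_graph (fan_graph m n))"
proof -
  have "({w, u} - {w, v}) \<union> ({w, v} - {w, u}) = {u, v}"
    using fan_arcD(2)[OF assms(1)] assms(3,4) by auto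
  then show ?thesis
    using fan_arcD(3,4)[OF assms(1)] assms by (auto simp: token_graph_def)
qed

text \<open>The moves made by the tour: in the first seven a token changes between the path and the
  edgeless part, in the last two it moves along the path.\<close>

lemma double_fan_arcs:
  shows "i < m \<Longrightarrow> k < m \<Longrightarrow> i \<noteq> k \<Longrightarrow> c < n \<Longrightarrow>
      ({Inl i, Inr c}, {Inl i, Inl k}) \<in> parcs (double_vertex_graph (fan_graph m n))"
    and "i < m \<Longrightarrow> k < m \<Longrightarrow> i \<noteq> k \<Longrightarrow> c < n \<Longrightarrow>
      ({Inl i, Inl k}, {Inl i, Inr c}) \<in> parcs (double_vertex_graph (fan_graph m n))"
    and "i < m \<Longrightarrow> k < m \<Longrightarrow> i \<noteq> k \<Longrightarrow> c < n \<Longrightarrow>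
      ({Inl i, Inl k}, {Inl k, Inr c}) \<in> parcs (double_vertex_graph (fan_graph m n))"
    and "i < m \<Longrightarrow> c < n \<Longrightarrow> d < n \<Longrightarrow> c \<noteq> d \<Longrightarrow>
      ({Inl i, Inr c}, {Inr c, Inr d}) \<in> parcs (double_vertex_graph (fan_graph m n))"
    and "i < m \<Longrightarrow> c < n \<Longrightarrow> d < n \<Longrightarrow> c \<noteq> d \<Longrightarrow>
      ({Inl i, Inr d}, {Inr c, Inr d}) \<in> parcs (double_vertex_graph (fan_graph m n))"
    and "i < m \<Longrightarrow> c < n \<Longrightarrow> d < n \<Longrightarrow> c \<noteq> d \<Longrightarrow>
      ({Inr c, Inr d}, {Inl i, Inr c}) \<in> parcs (double_vertex_graph (fan_graph m n))"
    and "i < m \<Longrightarrow> c < n \<Longrightarrow> d < n \<Longrightarrow> c \<noteq> d \<Longrightarrow>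
      ({Inr c, Inr d}, {Inl i, Inr d}) \<in> parcs (double_vertex_graph (fan_graph m n))"
    and "i < m \<Longrightarrow> Suc c < n \<Longrightarrow>
      ({Inl i, Inr c}, {Inl i, Inr (Suc c)}) \<in> parcs (double_vertex_graph (fan_graph m n))"
    and "c < d \<Longrightarrow> Suc d < n \<Longrightarrow>
      ({Inr c, Inr (Suc d)}, {Inr c, Inr d}) \<in> parcs (double_vertex_graph (fan_graph m n))"
          apply (rule double_fan_arcI[of "Inr c" "Inl k" _ _ "Inl i"]; auto simp: parcs_fan)
         apply (rule double_fan_arcI[of "Inl k" "Inr c" _ _ "Inl i"]; auto simp: parcs_fan)
        apply (rule double_fan_arcI[of "Inl i" "Inr c" _ _ "Inl k"]; auto simp: parcs_fan)
       apply (rule double_fan_arcI[of "Inl i" "Inr d" _ _ "Inr c"]; auto simp: parcs_fan)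
      apply (rule double_fan_arcI[of "Inl i" "Inr c" _ _ "Inr d"]; auto simp: parcs_fan)
     apply (rule double_fan_arcI[of "Inr d" "Inl i" _ _ "Inr c"]; auto simp: parcs_fan)
    apply (rule double_fan_arcI[of "Inr c" "Inl i" _ _ "Inr d"]; auto simp: parcs_fan)
   apply (rule double_fan_arcI[of "Inr c" "Inr (Suc c)" _ _ "Inl i"]; auto simp: parcs_fan)
  apply (rule double_fan_arcI[of "Inr (Suc d)" "Inr d" _ _ "Inr c"]; auto simp: parcs_fan)
  done

lemma successively_block:
  assumes "2 \<le> n" and "m \<le> 2 * n" and "r < m" and "c < n"
  shows "successively (\<lambda>X Y. (X, Y) \<in> parcs (double_vertex_graph (fan_graph m n))) (block m n r c)"
    (is "successively ?P _")
proof -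
  \<comment> \<open>The bound \<open>N\<close> is general because row 0 uses both
    \<open>n - 1\<close> and \<open>n\<close>.\<close>
  have inner: "successively ?P (map (\<lambda>d. {Inr c, Inr d}) (rev [Suc c..<N]))" if "N \<le> n" for N
    using that
  proof (induction N)
    case (Suc N)
    show ?case
    proof (cases "Suc c < N")
      case True
      then obtain M where "N = Suc M" "Suc c \<le> M"
        by (cases N) auto
      with Suc show ?thesis
        by (auto simp: successively_Cons intro: double_fan_arcs)
    qed simp
  qed simp
  have "successively ?P (gap m n r c)"
    using inner[of "n - 1"] inner[of n] by (auto simp: gap_def)
  moreover have "?P {Inl r, Inr c} (hd (gap m n r c))" if "gap m n r c \<noteq> []"
    using hd_in_set[OF that] assms(3,4,1)
  proof (cases rule: mem_gap_cases)
    case 1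
    then show ?thesis
      using assms double_fan_arcs(1)[of r m "Suc r" c n] by simp
  next
    case 2
    \<comment> \<open>The current column is the last one, so \<open>Inr (n - 1)\<close> is the token
      that stays.\<close>
    then have "n - 1 = c"
      by simp
    with 2 show ?thesis
      using assms double_fan_arcs(5)[of r m 0 n c] by simp
  next
    case (3 d)
    then show ?thesis
      using assms double_fan_arcs(4)[of r m c n d] by simp
  next
    case 4
    show ?thesis
      using 4(1,3) assms(3,4) partner_neq[OF assms(3,2) 4(1), symmetric]
        double_fan_arcs(1)[of r m "partner n r c" c n]
      by (simp add: 4(4))
  qed
  ultimately show ?thesis
    by (auto simp: block_def successively_Cons)
qed

text \<open>An empty gap leaves a move along the path. Otherwise the last inserted pair shares
  \<open>Inr (Suc c)\<close> with the next entry in row 0, and \<open>Inl r\<close> in the other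
  rows.\<close>

lemma last_block:
  assumes "2 \<le> n" and "m \<le> 2 * n" and "r < m" and "Suc c < n"
  shows "(last (block m n r c), {Inl r, Inr (Suc c)}) \<in> parcs (double_vertex_graph (fan_graph m n))"
proof (cases "gap m n r c = []")
  case True
  with assms show ?thesis
    by (simp add: block_def double_fan_arcs)
next
  case False
  show ?thesis
  proof (cases "r = 0")
    case True
    then have "last (gap m n r c) = {Inr c, Inr (Suc c)}"
      using False assms by (auto simp: gap_def last_map last_rev split: if_splits)
    then show ?thesis
      using False assms True by (simp add: block_def double_fan_arcs)
  next
    case r: False
    then have "last (gap m n r c) = {Inl r, Inl (partner n r c)}" "partner n r c < m"
      using False assms by (auto simp: gap_def split: if_splits)
    then show ?thesis
      using False assms partner_neq[OF assms(3,2,4)] by (simp add: block_def double_fan_arcs)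
  qed
qed

lemma hamiltonian_double_fan:
  assumes n: "2 \<le> n" and m: "1 \<le> m" "m \<le> 2 * n"
  shows "hamiltonian (double_vertex_graph (fan_graph m n))"
proof (rule hamiltonianI)
  let ?P = "\<lambda>X Y. (X, Y) \<in> parcs (double_vertex_graph (fan_graph m n))"
  have row: "successively ?P (row m n r)" "hd (row m n r) = {Inl r, Inr 0}" "row m n r \<noteq> []"
    "last (row m n r) = (if Suc r < m then {Inl r, Inl (Suc r)} else {Inr 0, Inr (n - 1)})"
    if r: "r < m" for r
  proof -
    have block: "block m n r c \<noteq> [] \<and> successively ?P (block m n r c)" if "c < n" for c
      using successively_block[OF n m(2) r that] by (simp add: block_def)
    have link: "?P (last (block m n r c)) (hd (block m n r (Suc c)))" if "Suc c < n" for c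
      using last_block[OF n m(2) r that] by (simp add: block_def)
    note * = successively_concat_map_upt[where P = ?P and f = "block m n r" and n = n, OF block link]
    show "successively ?P (row m n r)"
      unfolding row_def by (rule *)
    show "hd (row m n r) = {Inl r, Inr 0}"
      unfolding row_def using n by (subst *) (auto simp: block_def)
    show "last (row m n r) = (if Suc r < m then {Inl r, Inl (Suc r)} else {Inr 0, Inr (n - 1)})"
      unfolding row_def using n by (subst *) (auto simp: block_def gap_def)
    show "row m n r \<noteq> []"
      using n by (auto simp: row_def block_def intro: exI[of _ 0])
  qed
  have block: "row m n r \<noteq> [] \<and> successively ?P (row m n r)" if "r < m" for r
    using row[OF that] by simp
  \<comment> \<open>From \<open>{Inl r, Inl (Suc r)}\<close> the token on \<open>Inl r\<close> moves
    to \<open>Inr 0\<close>, the start of the next row.\<close>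
  have link: "?P (last (row m n r)) (hd (row m n (Suc r)))" if "Suc r < m" for r
    using row(4)[of r] row(2)[of "Suc r"] double_fan_arcs(3)[of r m "Suc r" 0 n] that n by simp
  note * = successively_concat_map_upt[where P = ?P and f = "row m n" and n = m, OF block link]
  show "successively ?P (tour m n)"
    unfolding tour_def by (rule *)
  have "hd (tour m n) = hd (row m n 0)"
    unfolding tour_def by (rule *(3)) (use m in linarith)+
  moreover have "last (tour m n) = last (row m n (m - 1))"
    unfolding tour_def by (rule *(2)) (use m in linarith)+
  ultimately have "hd (tour m n) = {Inl 0, Inr 0}" "last (tour m n) = {Inr 0, Inr (n - 1)}"
    using m row(2)[of 0] row(4)[of "m - 1"] by simp_all
  then show "?P (last (tour m n)) (hd (tour m n))"
    using n m double_fan_arcs(6)[of 0 m 0 n "n - 1"] by simp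
  show "distinct (tour m n)"
    using n m by (intro distinct_tour)
  show "set (tour m n) = pverts (double_vertex_graph (fan_graph m n))"
    using n m by (simp add: set_tour pverts_double_fan)
  \<comment> \<open>For \<open>m = 1\<close> and \<open>n = 2\<close> these three pairs are the
    whole graph.\<close>
  let ?Y = "{{Inl 0, Inr 0}, {Inl 0, Inr 1}, {Inr 0, Inr 1}} :: (nat + nat) set set"
  have "{Inl 0, Inr j} \<in> set (tour m n)" if "j < n" for j
    using n m that by (simp add: set_tour pairs_B_def image_iff doubleton_eq_iff)
  moreover have "{Inr 0, Inr 1} \<in> set (tour m n)"
    using n m by (simp add: set_tour pairs_C_def)
  ultimately have "?Y \<subseteq> set (tour m n)"
    using n by simp
  then have "card ?Y \<le> card (set (tour m n))"
    by (intro card_mono) simp_all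
  moreover have "card ?Y = 3"
    by (simp add: doubleton_eq_iff)
  ultimately have "3 \<le> card (set (tour m n))"
    by linarith
  then show "3 \<le> length (tour m n)"
    using card_length[of "tour m n"] by linarith
qed

text \<open>The graph is a subdivided triangle, hence itself a 6-cycle: pairs of type B are the
  corners, pairs of type A the subdivided sides.\<close>

lemma hamiltonian_double_fan_3_1: "hamiltonian (double_vertex_graph (fan_graph 3 1))"
proof (rule hamiltonianI)
  let ?vs = "[{Inl 0, Inr 0}, {Inl 0, Inl 1}, {Inl 1, Inr 0}, {Inl 1, Inl 2}, {Inl 2, Inr 0},
    {Inl 2, Inl 0}] :: (nat + nat) set list"
  show "distinct ?vs"
    by (auto simp: doubleton_eq_iff)
  show "set ?vs = pverts (double_vertex_graph (fan_graph 3 1))"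
  proof -
    have "pairs_A 3 = {{Inl 0, Inl 1}, {Inl 1, Inl 2}, {Inl 2, Inl 0}}"
    proof (intro equalityI subsetI)
      fix X assume "X \<in> pairs_A 3"
      then obtain i k where "i < k" "k < 3" and X: "X = {Inl i, Inl k}"
        by (auto simp: pairs_A_iff)
      then consider "i = 0" "k = 1" | "i = 1" "k = 2" | "i = 0" "k = 2"
        by linarith
      then show "X \<in> {{Inl 0, Inl 1}, {Inl 1, Inl 2}, {Inl 2, Inl 0}}"
        by cases (simp_all add: X insert_commute)
    qed (auto simp: pairs_A_def)
    moreover have "pairs_B 3 1 = {{Inl 0, Inr 0}, {Inl 1, Inr 0}, {Inl 2, Inr 0}}"
      by (auto simp: pairs_B_def lessThan_Suc numeral_3_eq_3)
    moreover have "pairs_C 1 = {}"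
      by (auto simp: pairs_C_iff)
    ultimately show ?thesis
      by (auto simp: pverts_double_fan)
  qed
  show "successively (\<lambda>u v. (u, v) \<in> parcs (double_vertex_graph (fan_graph 3 1))) ?vs"
    by (simp add: double_fan_arcs(1,3))
  show "(last ?vs, hd ?vs) \<in> parcs (double_vertex_graph (fan_graph 3 1))"
    by (simp add: double_fan_arcs(3))
qed simp

section \<open>Both directions combined\<close>

lemma hamiltonian_double_fan_one_iff:
  assumes "1 \<le> m"
  shows "hamiltonian (double_vertex_graph (fan_graph m 1)) \<longleftrightarrow> m = 3"
  using hamiltonian_double_fan_one[OF _ assms] hamiltonian_double_fan_3_1 by blast

lemma hamiltonian_double_fan_iff:
  assumes "1 \<le> m" and "2 \<le> n"
  shows "hamiltonian (double_vertex_graph (fan_graph m n)) \<longleftrightarrow> m \<le> 2 * n"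
  using hamiltonian_double_fan_bound[OF _ assms] hamiltonian_double_fan[OF assms(2,1)] by blast

theorem theorem1:
  fixes m n :: nat
  assumes "1 \<le> m" and "1 \<le> n"
  shows "hamiltonian (double_vertex_graph (fan_graph m n)) \<longleftrightarrow>
    (2 \<le> n \<and> 1 \<le> m \<and> m \<le> 2 * n) \<or> (n = 1 \<and> m = 3)"
proof (cases "n = 1")
  case True
  then show ?thesis
    using hamiltonian_double_fan_one_iff[OF assms(1)] by simp
next
  case False
  then have "2 \<le> n"
    using assms(2) by simp
  then show ?thesis
    using hamiltonian_double_fan_iff[OF assms(1)] assms(1) by simp
qed

end
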